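(* Let $\psi_0(z)=\frac{1+z}{1-z}$ and let $\varphi(z)=z+\sum_{k=2}^\infty\alpha_kz^k$ be a univalent convex function in the open unit disk $\mathbb{D}$. If $F\in\mathcal{A}_{\varphi,\psi_0}$, then for every $\lambda\in\mathbb{C}$ $$\left|\Phi_1(F,\lambda)\right|\le\left\{\begin{array}{lcl} |\lambda-1|+2+\frac{|1-2\lambda|^2}{2(1-|1-2\lambda|)}\,, & \quad & \mbox{if } |\lambda-\frac12|<\frac13\,,\\[2mm] |\lambda-1|+4|1-2\lambda|, & \quad & \mbox{if } |\lambda-\frac12|\ge\frac13\,. \end{array}\right.$$
   Context: $\mathcal{A}_{\varphi,\psi}$ is the class of functions $F$ holomorphic in $\mathbb{D}$ of the form $F(z)=\varphi(z)\psi(\omega(z))$, $z\in\mathbb{D}$, for some holomorphic self-mapping $\omega$ of $\mathbb{D}$ with $\omega(0)=0$. For $f(z)=\sum_{k=0}^\infty f_kz^k$ and $\lambda\in\mathbb{C}$, $\Phi_1(f,\lambda):=f_1f_3-\lambda f_2^2$. *)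

theory Defs
  imports "HOL-Complex_Analysis.Complex_Analysis"
begin

abbreviation unit_disk :: "complex set" where
  "unit_disk \<equiv> ball 0 1"

definition univalent_on :: "(complex \<Rightarrow> complex) \<Rightarrow> complex set \<Rightarrow> bool" where
  "univalent_on f S \<longleftrightarrow> f holomorphic_on S \<and> inj_on f S"

text \<open>A convex function in the sense of geometric function theory: the image domain is convex.\<close>

definition univalent_convex :: "(complex \<Rightarrow> complex) \<Rightarrow> bool" where
  "univalent_convex f \<longleftrightarrow> univalent_on f unit_disk \<and> convex (f ` unit_disk)"

text \<open>Members are total functions on the complex plane; only their values on the unit disk are
  constrained. The same holds for the inner function \<open>\<omega>\<close>.\<close>

definition class_A :: "(complex \<Rightarrow> complex) \<Rightarrow> (complex \<Rightarrow> complex) \<Rightarrow> (complex \<Rightarrow> complex) set" where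
  "class_A \<phi> \<psi> = {F. F holomorphic_on unit_disk \<and>
     (\<exists>\<omega>. \<omega> holomorphic_on unit_disk \<and> \<omega> ` unit_disk \<subseteq> unit_disk \<and> \<omega> 0 = 0 \<and>
          (\<forall>z\<in>unit_disk. F z = \<phi> z * \<psi> (\<omega> z)))}"

definition \<psi>\<^sub>0 :: "complex \<Rightarrow> complex" where
  "\<psi>\<^sub>0 z = (1 + z) / (1 - z)"

definition taylor_coeff :: "(complex \<Rightarrow> complex) \<Rightarrow> nat \<Rightarrow> complex" where
  "taylor_coeff f k = fps_nth (fps_expansion f 0) k"

definition \<Phi>\<^sub>1 :: "(complex \<Rightarrow> complex) \<Rightarrow> complex \<Rightarrow> complex" where
  "\<Phi>\<^sub>1 f \<mu> = taylor_coeff f 1 * taylor_coeff f 3 - \<mu> * (taylor_coeff f 2)\<^sup>2"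

end

theory Submission
  imports Defs
begin

text \<open>
  Write \<open>\<phi>(z) = z + a\<^sub>2 z\<^sup>2 + a\<^sub>3 z\<^sup>3 + \<dots>\<close> and \<open>\<omega>(z) = c\<^sub>1 z + c\<^sub>2 z\<^sup>2 + \<dots>\<close>. Comparing coefficients in
  \<open>F (1 - \<omega>) = \<phi> (1 + \<omega>)\<close> gives
  \<open>\<Phi>\<^sub>1 F \<mu> = (a\<^sub>3 - a\<^sub>2\<^sup>2) + (1 - \<mu>) a\<^sub>2\<^sup>2 + 2 (1 - 2\<mu>) a\<^sub>2 c\<^sub>1 + 2 c\<^sub>2 + 2 (1 - 2\<mu>) c\<^sub>1\<^sup>2\<close>.
  The triangle inequality suffices from here, provided that the two available pieces of information
  are used in their sharp form: \<open>\<bar>c\<^sub>2\<bar> \<le> 1 - \<bar>c\<^sub>1\<bar>\<^sup>2\<close> by the Schwarz-Pick lemma, and, for convex \<open>\<phi>\<close>,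
  \<open>\<bar>a\<^sub>2\<bar> \<le> 1\<close> together with Trimble's inequality \<open>\<bar>a\<^sub>3 - a\<^sub>2\<^sup>2\<bar> \<le> (1 - \<bar>a\<^sub>2\<bar>\<^sup>2) / 3\<close>. What remains is to
  maximise a polynomial in \<open>\<bar>a\<^sub>2\<bar>\<close> and \<open>\<bar>c\<^sub>1\<bar>\<close> over the unit square
  (lemma \<open>quadratic_max_on_unit_square\<close>).

  Trimble's inequality is obtained straight from the convexity of the image, without the
  differential characterisation \<open>Re (1 + z \<phi>'' / \<phi>') > 0\<close>. For \<open>u = exp (i t)\<close> with \<open>0 < t < \<pi>/2\<close>
  the midpoint of \<open>\<phi>(u z)\<close> and \<open>\<phi>(cnj u * z)\<close> lies in the image of \<open>\<phi>\<close>, hence equals \<open>\<phi>(h z)\<close> for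
  a holomorphic self-map \<open>h\<close> of the disk that fixes \<open>0\<close>. The first coefficient of \<open>h\<close> is \<open>cos t\<close>. Two
  steps of the Schur algorithm turn \<open>h\<close> into a function \<open>k\<close> bounded by \<open>1\<close> with
  \<open>k(z) = - a\<^sub>2 - 3 cos t (a\<^sub>3 - a\<^sub>2\<^sup>2) z + \<dots>\<close>: the powers of \<open>sin t\<close> by which the coefficients of \<open>h\<close>
  degenerate as \<open>t\<close> tends to \<open>0\<close> cancel exactly. The Schwarz-Pick inequality for \<open>k\<close> at \<open>0\<close> and
  \<open>cos t \<rightarrow> 1\<close> give both bounds (lemmas \<open>convex_coeff_bounds_rotation\<close> and \<open>convex_coeff_bounds\<close>).
\<close>

section \<open>The Schur algorithm and the Schwarz-Pick inequality at the origin\<close>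

text \<open>The value \<open>1\<close> is allowed for the modulus so that the class is closed under the Schur algorithm,
  which may end in a unimodular constant.\<close>
definition schur_function :: "(complex \<Rightarrow> complex) \<Rightarrow> bool" where
  "schur_function g \<longleftrightarrow> g holomorphic_on unit_disk \<and> (\<forall>z\<in>unit_disk. cmod (g z) \<le> 1)"

lemma fps_expansion_eq_on_disk:
  assumes "\<And>z. z \<in> unit_disk \<Longrightarrow> f z = g z" and "g has_fps_expansion G"
  shows "fps_expansion f 0 = G"
proof -
  have "eventually (\<lambda>z. z \<in> unit_disk) (nhds 0)"
    by (intro eventually_nhds_in_open) auto
  then have "eventually (\<lambda>z. f z = g z) (nhds 0)"
    by (rule eventually_mono) (use assms(1) in auto)
  then have "f has_fps_expansion G"
    using has_fps_expansion_cong[of f g G G] assms(2) by simp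
  then show ?thesis by (rule fps_expansion_eqI)
qed

lemma holomorphic_has_fps_expansion:
  assumes "f holomorphic_on unit_disk"
  shows "f has_fps_expansion fps_expansion f 0"
  by (rule has_fps_expansion_fps_expansion[of unit_disk]) (use assms in auto)

lemma fps_expansion_nth_0 [simp]: "fps_nth (fps_expansion f 0) 0 = f (0::complex)"
  by (simp add: fps_expansion_def)

lemma schur_function_attains_1_imp_constant:
  assumes "schur_function g" and "\<zeta> \<in> unit_disk" and "cmod (g \<zeta>) = 1" and "z \<in> unit_disk"
  shows "g z = g \<zeta>"
proof -
  have "g constant_on unit_disk"
    by (rule maximum_modulus_principle[of g unit_disk unit_disk \<zeta>])
       (use assms in \<open>auto simp: schur_function_def\<close>)
  then show ?thesis
    using assms by (auto simp: constant_on_def)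
qed

lemma schur_function_strict:
  assumes "schur_function g" and "cmod (g 0) < 1" and "z \<in> unit_disk"
  shows "cmod (g z) < 1"
proof (rule ccontr)
  assume "\<not> cmod (g z) < 1"
  then have "cmod (g z) = 1"
    using assms by (auto simp: schur_function_def intro: antisym)
  then have "g 0 = g z"
    using schur_function_attains_1_imp_constant[of g z 0] assms by simp
  with \<open>cmod (g z) = 1\<close> assms show False by simp
qed

text \<open>A Moebius map brings \<open>g 0\<close> to \<open>0\<close>, and Schwarz's lemma lets the resulting zero be divided out
  without losing the bound \<open>1\<close>. The equation is multiplied out so that it can be read as an identity
  of power series.\<close>
lemma schur_algorithm:
  assumes g: "schur_function g" and g0: "cmod (g 0) < 1"
  obtains k where "schur_function k"
    and "\<And>z. z \<in> unit_disk \<Longrightarrow> g z - g 0 = z * k z * (1 - cnj (g 0) * g z)"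
proof -
  define m where "m z = Moebius_function 0 (g 0) (g z)" for z
  have lt1: "cmod (g z) < 1" if "z \<in> unit_disk" for z
    using schur_function_strict[OF g g0 that] .
  have nz: "1 - cnj (g 0) * g z \<noteq> 0" if "z \<in> unit_disk" for z
  proof
    assume "1 - cnj (g 0) * g z = 0"
    then have "cmod (g 0) * cmod (g z) = 1"
      by (metis complex_mod_cnj eq_iff_diff_eq_0 norm_mult norm_one)
    moreover have "cmod (g 0) * cmod (g z) < 1"
      using mult_strict_mono[of "cmod (g 0)" 1 "cmod (g z)" 1] g0 lt1[OF that] by simp
    ultimately show False by simp
  qed
  have m_eq: "m z = (g z - g 0) / (1 - cnj (g 0) * g z)" for z
    by (simp add: m_def Moebius_function_def)
  have holm: "m holomorphic_on ball 0 1"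
    unfolding m_eq using g nz by (auto simp: schur_function_def intro!: holomorphic_intros)
  have m0: "m 0 = 0" by (simp add: m_eq)
  have m1: "cmod (m z) < 1" if "cmod z < 1" for z
    unfolding m_def by (rule Moebius_function_norm_lt_1) (use g0 lt1 that in auto)
  obtain k where k: "k holomorphic_on ball 0 1" "\<And>z. cmod z < 1 \<Longrightarrow> m z = z * k z" "deriv m 0 = k 0"
    using Schwarz3[OF holm m0] by blast
  have "cmod (k z) \<le> 1" if "cmod z < 1" for z
  proof (cases "z = 0")
    case True
    then show ?thesis using Schwarz_Lemma(2)[OF holm m0 m1, of 0] k(3) by simp
  next
    case False
    have "cmod z * cmod (k z) \<le> cmod z * 1"
      using Schwarz_Lemma(1)[OF holm m0 m1 that] k(2)[OF that] by (simp add: norm_mult)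
    then show ?thesis using False by (simp add: mult_le_cancel_left1 zero_less_mult_iff)
  qed
  then have "schur_function k"
    using k(1) by (auto simp: schur_function_def)
  moreover have "g z - g 0 = z * k z * (1 - cnj (g 0) * g z)" if "z \<in> unit_disk" for z
  proof -
    have "m z = z * k z" using k(2) that by simp
    then show ?thesis using nz[OF that] by (simp add: m_eq field_simps)
  qed
  ultimately show ?thesis using that by blast
qed

lemma schur_algorithm_fps:
  assumes g: "schur_function g" and g0: "cmod (g 0) < 1"
  obtains k where "schur_function k"
    and "fps_expansion g 0 - fps_const (g 0) =
         fps_X * fps_expansion k 0 * (1 - fps_const (cnj (g 0)) * fps_expansion g 0)"
proof -
  obtain k where k: "schur_function k"
    and eq: "\<And>z. z \<in> unit_disk \<Longrightarrow> g z - g 0 = z * k z * (1 - cnj (g 0) * g z)"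
    using schur_algorithm[OF assms] by blast
  have hg: "g has_fps_expansion fps_expansion g 0" and hk: "k has_fps_expansion fps_expansion k 0"
    using g k by (auto simp: schur_function_def intro: holomorphic_has_fps_expansion)
  have "fps_expansion (\<lambda>z. g z - g 0) 0 = fps_X * fps_expansion k 0 * (1 - fps_const (cnj (g 0)) * fps_expansion g 0)"
    by (rule fps_expansion_eq_on_disk[OF eq]) (auto intro!: fps_expansion_intros hg hk)
  moreover have "fps_expansion (\<lambda>z. g z - g 0) 0 = fps_expansion g 0 - fps_const (g 0)"
    by (rule fps_expansion_eqI) (intro fps_expansion_intros hg)
  ultimately show ?thesis using that k by simp
qed

text \<open>By one step of the Schur algorithm, the coefficient is \<open>(1 - \<bar>g 0\<bar>\<^sup>2) k(0)\<close> with \<open>\<bar>k(0)\<bar> \<le> 1\<close>. The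
  step is not available if \<open>\<bar>g 0\<bar> = 1\<close>, but then \<open>g\<close> is constant.\<close>
lemma schur_coeff_bound:
  assumes g: "schur_function g"
  shows "cmod (fps_nth (fps_expansion g 0) 1) \<le> 1 - (cmod (g 0))\<^sup>2"
proof (cases "cmod (g 0) < 1")
  case True
  obtain k where k: "schur_function k"
    and eq: "fps_expansion g 0 - fps_const (g 0) =
         fps_X * fps_expansion k 0 * (1 - fps_const (cnj (g 0)) * fps_expansion g 0)"
    using schur_algorithm_fps[OF g True] by blast
  have "fps_nth (fps_expansion g 0) 1 = k 0 * (1 - cnj (g 0) * g 0)"
    using arg_cong[OF eq, of "\<lambda>f. fps_nth f 1"]
    by (simp add: mult.assoc)
  also have "1 - cnj (g 0) * g 0 = of_real (1 - (cmod (g 0))\<^sup>2)"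
    by (simp only: mult.commute[of "cnj (g 0)"] complex_norm_square[symmetric] of_real_diff of_real_1)
  finally have "cmod (fps_nth (fps_expansion g 0) 1) = cmod (k 0) * (1 - (cmod (g 0))\<^sup>2)"
    using True by (simp add: norm_mult power_le_one del: of_real_diff)
  also have "\<dots> \<le> 1 * (1 - (cmod (g 0))\<^sup>2)"
    using k True by (intro mult_right_mono) (auto simp: schur_function_def power_le_one)
  finally show ?thesis by simp
next
  case False
  then have 1: "cmod (g 0) = 1"
    using g by (auto simp: schur_function_def intro: antisym)
  have "fps_expansion g 0 = fps_const (g 0)"
  proof (rule fps_expansion_eq_on_disk)
    show "g z = g 0" if "z \<in> unit_disk" for z
      by (rule schur_function_attains_1_imp_constant[OF g _ 1 that]) simp
  qed simp
  then have "fps_nth (fps_expansion g 0) 1 = fps_nth (fps_const (g 0)) 1" by simp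
  then show ?thesis using 1 by simp
qed

lemma self_map_fixing_0_factor:
  assumes h: "h holomorphic_on unit_disk" "h ` unit_disk \<subseteq> unit_disk" "h 0 = 0"
  obtains g where "schur_function g" and "fps_expansion h 0 = fps_X * fps_expansion g 0"
proof -
  have "schur_function h" 
    using h by (force simp: schur_function_def)
  from schur_algorithm_fps[OF this] obtain g where "schur_function g"
    "fps_expansion h 0 = fps_X * fps_expansion g 0" using h(3) by auto
  then show ?thesis using that by blast
qed

section \<open>Coefficients of convex functions\<close>

text \<open>Convexity enters the proof only here: the midpoint of two values of \<open>\<phi>\<close> is a value of \<open>\<phi>\<close>, and
  injectivity makes the preimage \<open>h z\<close> depend holomorphically on \<open>z\<close>.\<close>
lemma convex_symmetric_average:
  assumes \<phi>: "univalent_convex \<phi>" and \<phi>0: "\<phi> 0 = 0" and u: "cmod u = 1"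
  obtains h where "h holomorphic_on unit_disk" "h ` unit_disk \<subseteq> unit_disk" "h 0 = 0"
    and "\<And>z. z \<in> unit_disk \<Longrightarrow> \<phi> (h z) = (\<phi> (u * z) + \<phi> (cnj u * z)) / 2"
proof -
  have hol: "\<phi> holomorphic_on unit_disk" and inj: "inj_on \<phi> unit_disk"
    and conv: "convex (\<phi> ` unit_disk)"
    using \<phi> by (auto simp: univalent_convex_def univalent_on_def)
  obtain \<eta> where \<eta>: "\<eta> holomorphic_on (\<phi> ` unit_disk)" "\<And>z. z \<in> unit_disk \<Longrightarrow> \<eta> (\<phi> z) = z"
    by (rule holomorphic_has_inverse[OF hol open_ball inj]) (rule that)
  define avg where "avg z = (\<phi> (u * z) + \<phi> (cnj u * z)) / 2" for z
  have rot: "(\<lambda>z. \<phi> (v * z)) holomorphic_on unit_disk" if "cmod v = 1" for v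
  proof -
    have "(\<phi> \<circ> (\<lambda>z. v * z)) holomorphic_on unit_disk"
      by (rule holomorphic_on_compose_gen[OF _ hol])
        (use that in \<open>auto simp: norm_mult intro: holomorphic_on_mult\<close>)
    then show ?thesis by (simp add: o_def)
  qed
  have avg_hol: "avg holomorphic_on unit_disk"
    unfolding avg_def using u by (intro holomorphic_intros rot) auto
  have avg_in: "avg z \<in> \<phi> ` unit_disk" if "z \<in> unit_disk" for z
  proof -
    have "\<phi> (u * z) \<in> \<phi> ` unit_disk" "\<phi> (cnj u * z) \<in> \<phi> ` unit_disk"
      using that u by (auto simp: norm_mult)
    from convexD[OF conv this, of "1/2" "1/2"] show ?thesis
      by (simp add: avg_def scaleR_conv_of_real add_divide_distrib)
  qed
  show ?thesis
  proof (rule that[of "\<eta> \<circ> avg"])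
    show "(\<eta> \<circ> avg) holomorphic_on unit_disk"
      by (rule holomorphic_on_compose_gen[OF avg_hol \<eta>(1)]) (use avg_in in auto)
    show "(\<eta> \<circ> avg) ` unit_disk \<subseteq> unit_disk"
      using avg_in \<eta>(2) by fastforce
    show "(\<eta> \<circ> avg) 0 = 0"
      using \<eta>(2)[of 0] \<phi>0 by (simp add: avg_def)
    show "\<phi> ((\<eta> \<circ> avg) z) = (\<phi> (u * z) + \<phi> (cnj u * z)) / 2" if "z \<in> unit_disk" for z
      using avg_in[OF that] \<eta>(2) by (force simp: avg_def)
  qed
qed

lemma fps_compose_X_mult_nth:
  fixes P G :: "complex fps"
  shows "fps_nth (P oo (fps_X * G)) 1 = fps_nth P 1 * fps_nth G 0"
    and "fps_nth (P oo (fps_X * G)) 2 = fps_nth P 1 * fps_nth G 1 + fps_nth P 2 * (fps_nth G 0)\<^sup>2"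
    and "fps_nth (P oo (fps_X * G)) 3 = fps_nth P 1 * fps_nth G 2
           + 2 * fps_nth P 2 * fps_nth G 0 * fps_nth G 1 + fps_nth P 3 * fps_nth G 0 ^ 3"
  by (simp_all add: fps_compose_nth numeral_eq_Suc power_mult_distrib fps_X_power_mult_nth fps_mult_nth
       fps_power_zeroth algebra_simps del: power_Suc)
     (simp_all add: fps_mult_nth algebra_simps)

text \<open>Here \<open>c\<close> is the cosine of the angle of rotation. Below, \<open>h(z) = z g(z)\<close> is the self-map
  of lemma \<open>convex_symmetric_average\<close>, and \<open>k\<close> is the Schur transform of \<open>g\<close>. For \<open>c = 1\<close> the map \<open>h\<close>
  would be the identity, for which the Schur algorithm stops before \<open>k\<close> is reached; this is why
  \<open>c = 1\<close> has to be approached as a limit afterwards.\<close>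
lemma convex_coeff_bounds_rotation:
  assumes \<phi>: "univalent_convex \<phi>" and \<phi>0: "\<phi> 0 = 0" and \<phi>1: "fps_nth (fps_expansion \<phi> 0) 1 = 1"
    and c: "0 < c" "c < 1"
  defines "a \<equiv> fps_nth (fps_expansion \<phi> 0)"
  shows "cmod (a 2) \<le> 1" "c * (3 * cmod (a 3 - (a 2)\<^sup>2)) \<le> 1 - (cmod (a 2))\<^sup>2"
proof -
  define u where "u = Complex c (sqrt (1 - c\<^sup>2))"
  have u: "cmod u = 1"
    using c by (simp add: u_def cmod_def power_le_one)
  have u_sum: "u + cnj u = 2 * of_real c" 
    by (simp add: u_def complex_eq_iff)
  have u_prod: "u * cnj u = 1"
    using u by (simp add: complex_norm_square[symmetric])
  obtain h where h: "h holomorphic_on unit_disk" "h ` unit_disk \<subseteq> unit_disk" "h 0 = 0"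
    and avg: "\<And>z. z \<in> unit_disk \<Longrightarrow> \<phi> (h z) = (\<phi> (u * z) + \<phi> (cnj u * z)) / 2"
    using convex_symmetric_average[OF \<phi> \<phi>0 u] by blast
  obtain g where g: "schur_function g" and hg: "fps_expansion h 0 = fps_X * fps_expansion g 0"
    using self_map_fixing_0_factor[OF h] by blast
  define P where "P = fps_expansion \<phi> 0"
  have hP: "\<phi> has_fps_expansion P"
    using \<phi> by (auto simp: P_def univalent_convex_def univalent_on_def intro: holomorphic_has_fps_expansion)
  have hh: "h has_fps_expansion fps_X * fps_expansion g 0"
    using holomorphic_has_fps_expansion[OF h(1)] hg by simp
  have comp: "(\<phi> \<circ> h) has_fps_expansion (P oo (fps_X * fps_expansion g 0))"
    by (rule has_fps_expansion_compose[OF hP hh]) simp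
  have lin: "(\<lambda>z. \<phi> (v * z)) has_fps_expansion (P oo (fps_const v * fps_X))" for v
    using has_fps_expansion_compose[OF hP, of "\<lambda>z. v * z" "fps_const v * fps_X"]
    by (simp add: o_def has_fps_expansion_cmult_left has_fps_expansion_fps_X)
  have "fps_expansion (\<phi> \<circ> h) 0 = fps_const (1/2) * ((P oo (fps_const u * fps_X)) + (P oo (fps_const (cnj u) * fps_X)))"
  proof (rule fps_expansion_eq_on_disk)
    show "(\<phi> \<circ> h) z = 1/2 * (\<phi> (u * z) + \<phi> (cnj u * z))" if "z \<in> unit_disk" for z
      using avg[OF that] by simp
  qed (intro has_fps_expansion_cmult_left has_fps_expansion_add lin)
  moreover have "fps_expansion (\<phi> \<circ> h) 0 = P oo (fps_X * fps_expansion g 0)"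
    using comp by (rule fps_expansion_eqI)
  ultimately have E: "fps_nth (P oo (fps_X * fps_expansion g 0)) n = (u ^ n + cnj u ^ n) / 2 * a n" for n
    by (simp add: fps_compose_linear a_def P_def add_divide_distrib distrib_right)
  define G where "G = fps_nth (fps_expansion g 0)"
  have aP: "fps_nth P n = a n" for n by (simp add: P_def a_def)
  have a1: "a 1 = 1" using \<phi>1 by (simp add: a_def)
  define C where "C = complex_of_real c"
  \<comment> \<open>the Chebyshev polynomials of degree 2 and 3, i.e. \<open>cos (2 t)\<close> and \<open>cos (3 t)\<close>\<close>
  have u2: "(u ^ 2 + cnj u ^ 2) / 2 = 2 * C\<^sup>2 - 1"
    and u3: "(u ^ 3 + cnj u ^ 3) / 2 = 4 * C ^ 3 - 3 * C"
    using u_sum u_prod unfolding C_def[symmetric] by algebra+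
  have G0: "G 0 = C"
    using E[of 1] u_sum unfolding power_one_right fps_compose_X_mult_nth aP a1 G_def C_def by simp
  have G1: "G 1 = - a 2 * (1 - C\<^sup>2)"
    using E[of 2] unfolding u2 fps_compose_X_mult_nth aP a1 G_def[symmetric] G0 by algebra
  have G2: "G 2 = - C * (1 - C\<^sup>2) * (3 * a 3 - 2 * (a 2)\<^sup>2)"
    using E[of 3] unfolding u3 fps_compose_X_mult_nth aP a1 G_def[symmetric] G0 G1 by algebra
  have g0: "g 0 = C" using G0 by (simp add: G_def)
  have "cmod (g 0) < 1" using c by (simp add: g0 C_def)
  then obtain k where k: "schur_function k"
    and kg: "fps_expansion g 0 - fps_const (g 0) =
         fps_X * fps_expansion k 0 * (1 - fps_const (cnj (g 0)) * fps_expansion g 0)"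
    using schur_algorithm_fps[OF g] by blast
  have s: "1 - C\<^sup>2 \<noteq> 0"
  proof -
    have "c\<^sup>2 < 1" using c by (simp add: power_less_one_iff)
    then show ?thesis
      by (metis C_def eq_iff_diff_eq_0 of_real_1 of_real_eq_iff of_real_power order_less_irrefl)
  qed
  have cC: "cnj C = C" by (simp add: C_def)
  define K where "K = fps_nth (fps_expansion k 0)"
  have k1: "G 1 = K 0 * (1 - C * G 0)"
    using arg_cong[OF kg, of "\<lambda>f. fps_nth f 1"] by (simp add: mult.assoc g0 cC G_def K_def)
  have k2: "G 2 = K 1 * (1 - C * G 0) - K 0 * C * G 1"
    using arg_cong[OF kg, of "\<lambda>f. fps_nth f 2"]
    by (simp add: mult.assoc g0 cC G_def K_def numeral_2_eq_2 fps_mult_nth algebra_simps)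
  \<comment> \<open>both sides carry the factor \<open>1 - C\<^sup>2\<close>, the squared sine of the angle\<close>
  have K0: "K 0 = - a 2"
  proof -
    have "(1 - C\<^sup>2) * K 0 = (1 - C\<^sup>2) * (- a 2)" using k1 unfolding G1 G0 by algebra
    then show ?thesis using s by (simp only: mult_cancel_left) simp
  qed
  have K1: "K 1 = - of_real (3 * c) * (a 3 - (a 2)\<^sup>2)"
  proof -
    have "(1 - C\<^sup>2) * K 1 = (1 - C\<^sup>2) * (- (3 * C) * (a 3 - (a 2)\<^sup>2))"
      using k2 unfolding G2 G1 G0 K0 by algebra
    then show ?thesis using s by (simp only: mult_cancel_left) (simp add: C_def)
  qed
  have k0: "k 0 = - a 2" using K0 by (simp add: K_def)
  show "cmod (a 2) \<le> 1"
    using k k0 by (auto simp: schur_function_def dest: bspec[of _ _ 0])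
  have "cmod (K 1) = c * (3 * cmod (a 3 - (a 2)\<^sup>2))"
    unfolding K1 using c by (simp add: norm_mult)
  then show "c * (3 * cmod (a 3 - (a 2)\<^sup>2)) \<le> 1 - (cmod (a 2))\<^sup>2"
    using schur_coeff_bound[OF k] by (simp add: K_def k0)
qed

lemma convex_coeff_bounds:
  assumes \<phi>: "univalent_convex \<phi>" and \<phi>0: "\<phi> 0 = 0" and \<phi>1: "fps_nth (fps_expansion \<phi> 0) 1 = 1"
  defines "a \<equiv> fps_nth (fps_expansion \<phi> 0)"
  shows "cmod (a 2) \<le> 1" "3 * cmod (a 3 - (a 2)\<^sup>2) \<le> 1 - (cmod (a 2))\<^sup>2"
proof -
  show "cmod (a 2) \<le> 1"
    unfolding a_def by (rule convex_coeff_bounds_rotation[OF \<phi> \<phi>0 \<phi>1, of "1/2"]) auto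
  show "3 * cmod (a 3 - (a 2)\<^sup>2) \<le> 1 - (cmod (a 2))\<^sup>2"
    unfolding a_def by (rule field_le_mult_one_interval) (rule convex_coeff_bounds_rotation[OF \<phi> \<phi>0 \<phi>1])
qed

section \<open>The extremal problem in two moduli\<close>

text \<open>Here \<open>a = \<bar>a\<^sub>2\<bar>\<close>, \<open>c = \<bar>c\<^sub>1\<bar>\<close>, \<open>m = \<bar>1 - \<mu>\<bar>\<close> and \<open>D = \<bar>1 - 2\<mu>\<bar>\<close>. The right-hand side is the maximum over
  \<open>c\<close> for \<open>a = 1\<close>, attained at \<open>c = D / (2 (1 - D))\<close> as long as this is at most \<open>1\<close>, that is \<open>D \<le> 2/3\<close>, and at
  \<open>c = 1\<close> otherwise. The danger is \<open>m < 1/3\<close>, where the first two terms alone would prefer a small \<open>a\<close>;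
  but then \<open>1 - D \<le> 2 m\<close> forces \<open>D\<close> to be large enough for the mixed term \<open>2 a c D\<close> to outweigh
  this.\<close>
lemma quadratic_max_on_unit_square:
  fixes a c m D :: real
  assumes "0 \<le> a" "a \<le> 1" "0 \<le> c" "c \<le> 1" "0 \<le> m" "0 \<le> D" and mD: "1 - D \<le> 2 * m"
  shows "(1 - a\<^sup>2) / 3 + m * a\<^sup>2 + 2 * a * c * D + 2 * (1 - c\<^sup>2) + 2 * c\<^sup>2 * D \<le>
    (if D < 2 / 3 then m + 2 + D\<^sup>2 / (2 * (1 - D)) else m + 4 * D)"
proof -
  have a2: "0 \<le> 1 - a\<^sup>2" and c2: "0 \<le> 1 - c\<^sup>2"
    using assms by (auto simp: power_le_one)
  show ?thesis
  proof (cases "D < 2/3")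
    case True
    define V where "V = D\<^sup>2 / (2 * (1 - D))"
    have V: "2 * (1 - D) * V = D\<^sup>2" using True by (simp add: V_def)
    \<comment> \<open>completing the square in \<open>c\<close>\<close>
    have sq: "2 * a * c * D - 2 * c\<^sup>2 * (1 - D) \<le> a\<^sup>2 * V"
    proof -
      have "2 * (1 - D) * (a\<^sup>2 * V - (2 * a * c * D - 2 * c\<^sup>2 * (1 - D))) = (a * D - 2 * c * (1 - D))\<^sup>2"
        using V by algebra
      then have "0 \<le> 2 * (1 - D) * (a\<^sup>2 * V - (2 * a * c * D - 2 * c\<^sup>2 * (1 - D)))" by simp
      then show ?thesis using True by (simp add: zero_le_mult_iff)
    qed
    have "1/3 - (1 - D)/2 \<le> V"
    proof -
      have "2 * (1 - D) * (1/3 - (1 - D)/2) \<le> D\<^sup>2"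
      proof -
        have "2 * (1 - D) * (1/3 - (1 - D)/2) = D\<^sup>2 - 2 * (D - 1/3)\<^sup>2 - 1/9"
          by (simp add: power2_eq_square field_simps)
        then show ?thesis using zero_le_power2[of "D - 1/3"] by linarith
      qed
      then have "2 * (1 - D) * (1/3 - (1 - D)/2) \<le> 2 * (1 - D) * V" by (simp only: V)
      then show ?thesis using True by (simp add: mult_le_cancel_left_pos[of "2 * (1 - D)"])
    qed
    then have "1/3 - m \<le> V" using mD by argo
    then have "(1 - a\<^sup>2) * (1/3 - m) \<le> (1 - a\<^sup>2) * V"
      by (intro mult_left_mono a2)
    with sq have "(1 - a\<^sup>2) / 3 + m * a\<^sup>2 + 2 * a * c * D + 2 * (1 - c\<^sup>2) + 2 * c\<^sup>2 * D \<le> m + 2 + V"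
      by (simp add: algebra_simps diff_divide_distrib)
    then show ?thesis using True by (simp add: V_def)
  next
    case False
    \<comment> \<open>The gap between the two sides is at least \<open>D (a - c)\<^sup>2\<close>: it is
      \<open>2 D (1 - a c) - 2 (1 - D) (1 - c\<^sup>2) - (1 - a\<^sup>2) (1/3 - m)\<close>, and the last two terms are at least
      \<open>- D (1 - c\<^sup>2)\<close> and \<open>- D (1 - a\<^sup>2)\<close>.\<close>
    have "(1 - a\<^sup>2) * (1/3 - m) \<le> (1 - a\<^sup>2) * D"
      by (rule mult_left_mono[OF _ a2]) (use assms False in linarith)
    moreover have "2 * (1 - D) * (1 - c\<^sup>2) \<le> D * (1 - c\<^sup>2)"
      by (rule mult_right_mono[OF _ c2]) (use False in \<open>simp add: not_less field_simps\<close>)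
    moreover have "0 \<le> D * (a - c)\<^sup>2" using assms by simp
    ultimately have "(1 - a\<^sup>2) / 3 + m * a\<^sup>2 + 2 * a * c * D + 2 * (1 - c\<^sup>2) + 2 * c\<^sup>2 * D \<le> m + 4 * D"
      by (simp add: power2_eq_square algebra_simps)
    then show ?thesis using False by simp
  qed
qed

section \<open>Coefficients of the class and the final estimate\<close>

text \<open>Multiplying \<open>F = \<phi> \<psi>\<^sub>0(\<omega>)\<close> by \<open>1 - \<omega>\<close> avoids dividing power series; the coefficients of \<open>F\<close> then come
  out one after the other. The numbers \<open>c1\<close> and \<open>c2\<close> are the coefficients of \<open>z\<close> and \<open>z\<^sup>2\<close> in \<open>\<omega>\<close>.\<close>
lemma class_A_\<psi>\<^sub>0_coeffs:
  assumes F: "F \<in> class_A \<phi> \<psi>\<^sub>0" and \<phi>: "\<phi> holomorphic_on unit_disk"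
    and \<phi>0: "\<phi> 0 = 0" and \<phi>1: "fps_nth (fps_expansion \<phi> 0) 1 = 1"
  defines "a \<equiv> fps_nth (fps_expansion \<phi> 0)"
  obtains c1 c2 where "cmod c1 \<le> 1" "cmod c2 \<le> 1 - (cmod c1)\<^sup>2"
    "taylor_coeff F 1 = 1" "taylor_coeff F 2 = a 2 + 2 * c1"
    "taylor_coeff F 3 = a 3 + 2 * a 2 * c1 + 2 * c2 + 2 * c1\<^sup>2"
proof -
  obtain \<omega> where holF: "F holomorphic_on unit_disk"
    and w: "\<omega> holomorphic_on unit_disk" "\<omega> ` unit_disk \<subseteq> unit_disk" "\<omega> 0 = 0"
    and Fw: "\<And>z. z \<in> unit_disk \<Longrightarrow> F z = \<phi> z * \<psi>\<^sub>0 (\<omega> z)"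
    using F by (auto simp: class_A_def)
  obtain g where g: "schur_function g" and wg: "fps_expansion \<omega> 0 = fps_X * fps_expansion g 0"
    using self_map_fixing_0_factor[OF w] by blast
  have hw: "\<omega> has_fps_expansion fps_X * fps_expansion g 0"
    using holomorphic_has_fps_expansion[OF w(1)] wg by simp
  have hF: "F has_fps_expansion fps_expansion F 0" and h\<phi>: "\<phi> has_fps_expansion fps_expansion \<phi> 0"
    using holF \<phi> by (auto intro: holomorphic_has_fps_expansion)
  have "fps_expansion (\<lambda>z. F z * (1 - \<omega> z)) 0 = fps_expansion \<phi> 0 * (1 + fps_X * fps_expansion g 0)"
  proof (rule fps_expansion_eq_on_disk)
    fix z :: complex assume z: "z \<in> unit_disk"
    then have "\<omega> z \<noteq> 1" using w(2) by fastforce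
    then show "F z * (1 - \<omega> z) = \<phi> z * (1 + \<omega> z)"
      by (simp add: Fw[OF z] \<psi>\<^sub>0_def)
  qed (intro fps_expansion_intros h\<phi> hw)
  moreover have "fps_expansion (\<lambda>z. F z * (1 - \<omega> z)) 0 = fps_expansion F 0 * (1 - fps_X * fps_expansion g 0)"
    by (rule fps_expansion_eqI) (intro fps_expansion_intros hF hw)
  ultimately have E: "fps_expansion F 0 * (1 - fps_X * fps_expansion g 0) =
      fps_expansion \<phi> 0 * (1 + fps_X * fps_expansion g 0)" by simp
  have F0: "F 0 = 0" using Fw[of 0] \<phi>0 by simp
  define c1 c2 where "c1 = g 0" and "c2 = fps_nth (fps_expansion g 0) 1"
  have "cmod c1 \<le> 1" using g by (simp add: schur_function_def c1_def)
  moreover have "cmod c2 \<le> 1 - (cmod c1)\<^sup>2"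
    using schur_coeff_bound[OF g] by (simp add: c1_def c2_def)
  moreover have F1: "taylor_coeff F 1 = 1"
    using arg_cong[OF E, of "\<lambda>f. fps_nth f 1"] F0 \<phi>0 \<phi>1
    by (simp add: fps_mult_nth taylor_coeff_def)
  moreover have F2: "taylor_coeff F 2 = a 2 + 2 * c1"
    using arg_cong[OF E, of "\<lambda>f. fps_nth f 2"] F0 F1 \<phi>0 \<phi>1
    by (simp add: fps_mult_nth taylor_coeff_def numeral_eq_Suc a_def c1_def algebra_simps)
  moreover have "taylor_coeff F 3 = a 3 + 2 * a 2 * c1 + 2 * c2 + 2 * c1\<^sup>2"
    using arg_cong[OF E, of "\<lambda>f. fps_nth f 3"] F0 F1 F2 \<phi>0 \<phi>1
    by (simp add: fps_mult_nth taylor_coeff_def numeral_eq_Suc a_def c1_def c2_def algebra_simps)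
  ultimately show ?thesis using that by blast
qed

theorem theorem5p2:
  fixes \<phi> F :: "complex \<Rightarrow> complex" and \<alpha> :: "nat \<Rightarrow> complex" and \<mu> :: complex
  assumes "univalent_convex \<phi>"
    and "\<And>z. z \<in> unit_disk \<Longrightarrow> (\<lambda>k. \<alpha> (k + 2) * z ^ (k + 2)) sums (\<phi> z - z)"
    and "F \<in> class_A \<phi> \<psi>\<^sub>0"
  shows "cmod (\<Phi>\<^sub>1 F \<mu>) \<le>
    (if cmod (\<mu> - 1 / 2) < 1 / 3
     then cmod (\<mu> - 1) + 2 + (cmod (1 - 2 * \<mu>))\<^sup>2 / (2 * (1 - cmod (1 - 2 * \<mu>)))
     else cmod (\<mu> - 1) + 4 * cmod (1 - 2 * \<mu>))"
proof -
  have hol: "\<phi> holomorphic_on unit_disk"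
    using assms(1) by (simp add: univalent_convex_def univalent_on_def)
  have "\<phi> has_fps_expansion Abs_fps (\<lambda>n. if n = 0 then 0 else if n = 1 then 1 else \<alpha> n)" (is "_ has_fps_expansion ?A")
  proof (rule has_fps_expansionI)
    have "(\<lambda>n. fps_nth ?A n * z ^ n) sums \<phi> z" if "z \<in> unit_disk" for z
      using assms(2)[OF that] sums_iff_shift[of "\<lambda>n. fps_nth ?A n * z ^ n" 2 "\<phi> z - z"]
      by (simp add: numeral_2_eq_2)
    moreover have "eventually (\<lambda>z::complex. z \<in> unit_disk) (nhds 0)"
      by (intro eventually_nhds_in_open) auto
    ultimately show "\<forall>\<^sub>F z in nhds 0. (\<lambda>n. fps_nth ?A n * z ^ n) sums \<phi> z"
      by (auto elim: eventually_mono)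
  qed
  then have exp: "fps_expansion \<phi> 0 = ?A" by (rule fps_expansion_eqI)
  have \<phi>0: "\<phi> 0 = 0" using fps_expansion_nth_0[of \<phi>] exp by simp
  have \<phi>1: "fps_nth (fps_expansion \<phi> 0) 1 = 1" by (simp add: exp)
  define a where "a = fps_nth (fps_expansion \<phi> 0)"
  note bounds = convex_coeff_bounds[OF assms(1) \<phi>0 \<phi>1, folded a_def]
  obtain c1 c2 where c: "cmod c1 \<le> 1" "cmod c2 \<le> 1 - (cmod c1)\<^sup>2"
    and F: "taylor_coeff F 1 = 1" "taylor_coeff F 2 = a 2 + 2 * c1"
      "taylor_coeff F 3 = a 3 + 2 * a 2 * c1 + 2 * c2 + 2 * c1\<^sup>2"
    using class_A_\<psi>\<^sub>0_coeffs[OF assms(3) hol \<phi>0 \<phi>1] unfolding a_def by blast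
  define D where "D = cmod (1 - 2 * \<mu>)"
  have \<Phi>: "\<Phi>\<^sub>1 F \<mu> = (a 3 - (a 2)\<^sup>2) + (1 - \<mu>) * (a 2)\<^sup>2
      + 2 * a 2 * c1 * (1 - 2 * \<mu>) + 2 * c2 + 2 * c1\<^sup>2 * (1 - 2 * \<mu>)"
    unfolding \<Phi>\<^sub>1_def F by algebra
  have "cmod (\<Phi>\<^sub>1 F \<mu>) \<le> cmod (a 3 - (a 2)\<^sup>2) + cmod (1 - \<mu>) * (cmod (a 2))\<^sup>2
      + 2 * cmod (a 2) * cmod c1 * D + 2 * cmod c2 + 2 * (cmod c1)\<^sup>2 * D"
    unfolding \<Phi> D_def
    by (intro norm_triangle_mono) (simp_all add: norm_mult norm_power)
  also have "\<dots> \<le> (1 - (cmod (a 2))\<^sup>2) / 3 + cmod (\<mu> - 1) * (cmod (a 2))\<^sup>2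
      + 2 * cmod (a 2) * cmod c1 * D + 2 * (1 - (cmod c1)\<^sup>2) + 2 * (cmod c1)\<^sup>2 * D"
    unfolding norm_minus_commute[of 1 \<mu>] using bounds(2) c(2) by argo
  also have "\<dots> \<le> (if D < 2 / 3 then cmod (\<mu> - 1) + 2 + D\<^sup>2 / (2 * (1 - D)) else cmod (\<mu> - 1) + 4 * D)"
  proof (rule quadratic_max_on_unit_square)
    have "cmod (2 * (\<mu> - 1) + (1 - 2 * \<mu>)) \<le> 2 * cmod (\<mu> - 1) + D"
      unfolding D_def by (rule norm_triangle_mono) (simp_all only: norm_mult norm_numeral order_refl)
    then show "1 - D \<le> 2 * cmod (\<mu> - 1)" by (simp add: algebra_simps)
  qed (use bounds(1) c(1) in \<open>auto simp: D_def\<close>)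
  also have "D < 2 / 3 \<longleftrightarrow> cmod (\<mu> - 1 / 2) < 1 / 3"
  proof -
    have "D = cmod (2 * (\<mu> - 1 / 2))"
      unfolding D_def by (subst norm_minus_commute) (simp add: algebra_simps)
    then show ?thesis by (simp only: norm_mult norm_numeral) linarith
  qed
  finally show ?thesis by (simp only: D_def)
qed

end
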